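(* Let $\Gamma$ be a primitively log divergent graph with $|E(\Gamma)|=2n$ and $n\le5$. Then one of the following holds: (i) $n=3$ and $\Gamma\cong WS_3$; (ii) $n=4$ and $\Gamma\cong WS_4$; (iii) $n=5$ and $\Gamma$ is isomorphic to one of the graphs $WS_5$, $ZZ_5$, $XX_5$, $ST_5$.
   Context: Graphs are finite, connected, with at least one edge, and without multiple edges or self-loops. For a graph $\Gamma$ let $h_1(\Gamma)=\mathrm{rank}\,H_1(\Gamma,\mathbb{Z})$. $\Gamma$ is convergent if $|E(\Gamma)|>2h_1(\Gamma)$ and logarithmically divergent if $|E(\Gamma)|=2h_1(\Gamma)$; a logarithmically divergent graph is primitively log divergent if every connected proper subgraph (with nonempty edge set a proper subset of the edges) is convergent. The graphs: - $WS_n$ ($n\ge3$), the wheel with $n$ spokes: a center $v_0$ joined to each of $v_1,\dots,v_n$, and the cycle $v_1v_2\cdots v_nv_1$ ($2n$ edges). - $ZZ_5$: vertices $1,\dots,6$, edges $\{i,i+1\}$ ($1\le i\le5$), $\{i,i+2\}$ ($1\le i\le4$), $\{1,6\}$. - $XX_5$: vertices $1,\dots,6$; each of $1,2$ is joined to each of $3,4,5,6$; plus edges $\{3,4\}$, $\{5,6\}$. - $ST_5$: vertices $1,\dots,6$; edges $\{1,2\}$; $\{1,j\},\{2,j\},\{6,j\}$ for $j=3,4,5$. *)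

theory Defs
  imports Complex_Main "HOL-Library.Function_Algebras"
begin

record 'a ugraph =
  verts :: "'a set"
  edges :: "'a set set"

definition simple_graph :: "'a ugraph \<Rightarrow> bool" where
  "simple_graph G \<longleftrightarrow> finite (verts G) \<and>
     (\<forall>e\<in>edges G. \<exists>u\<in>verts G. \<exists>v\<in>verts G. u \<noteq> v \<and> e = {u, v})"

definition connected_graph :: "'a ugraph \<Rightarrow> bool" where
  "connected_graph G \<longleftrightarrow> verts G \<noteq> {} \<and>
     (\<forall>u\<in>verts G. \<forall>v\<in>verts G. (u, v) \<in> {(x, y). {x, y} \<in> edges G}\<^sup>*)"

definition graph :: "'a ugraph \<Rightarrow> bool" where
  "graph G \<longleftrightarrow> simple_graph G \<and> connected_graph G \<and> edges G \<noteq> {}"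

definition subgraph :: "'a ugraph \<Rightarrow> 'a ugraph \<Rightarrow> bool" where
  "subgraph H G \<longleftrightarrow> simple_graph H \<and> verts H \<subseteq> verts G \<and> edges H \<subseteq> edges G"

definition isomorphic :: "'a ugraph \<Rightarrow> 'b ugraph \<Rightarrow> bool" where
  "isomorphic G H \<longleftrightarrow>
     (\<exists>f. bij_betw f (verts G) (verts H) \<and> edges H = (\<lambda>e. f ` e) ` edges G)"

text \<open>
  The group of simplicial 1-chains with integer coefficients, without choosing an orientation:
  the coefficient of the oriented edge from \<open>u\<close> to \<open>v\<close> is \<open>c (u, v)\<close>, and reversing
  an edge changes the sign.  It is isomorphic to the free abelian group on the edges.
\<close>

definition chains1 :: "'a ugraph \<Rightarrow> ('a \<times> 'a \<Rightarrow> int) set" where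
  "chains1 G = {c. (\<forall>u v. c (v, u) = - c (u, v)) \<and> (\<forall>u v. {u, v} \<notin> edges G \<longrightarrow> c (u, v) = 0)}"

text \<open>The oriented edge from \<open>u\<close> to \<open>v\<close> has boundary \<open>v - u\<close>.\<close>

definition boundary1 :: "'a ugraph \<Rightarrow> ('a \<times> 'a \<Rightarrow> int) \<Rightarrow> 'a \<Rightarrow> int" where
  "boundary1 G c v = (\<Sum>u\<in>verts G. c (u, v))"

text \<open>A graph has no 2-simplices, so its first homology group is the kernel of the boundary map.\<close>

definition H1 :: "'a ugraph \<Rightarrow> ('a \<times> 'a \<Rightarrow> int) set" where
  "H1 G = {c \<in> chains1 G. \<forall>v\<in>verts G. boundary1 G c v = 0}"

global_interpretation int_fun: module "\<lambda>(k::int) (c::'b \<Rightarrow> int) x. k * c x"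
  by standard (auto simp: fun_eq_iff algebra_simps)

text \<open>
  The rank of a subgroup \<open>A\<close> of a group of integer-valued functions is the maximal size of a
  subset of \<open>A\<close> that is linearly independent over the integers; this is meant for groups of
  finite rank, such as \<open>H1 G\<close> for a finite graph \<open>G\<close>.
\<close>

definition int_rank :: "('b \<Rightarrow> int) set \<Rightarrow> nat" where
  "int_rank A = Max {card B | B. finite B \<and> B \<subseteq> A \<and> int_fun.independent B}"

definition h1 :: "'a ugraph \<Rightarrow> nat" where
  "h1 G = int_rank (H1 G)"

definition convergent_graph :: "'a ugraph \<Rightarrow> bool" where
  "convergent_graph G \<longleftrightarrow> card (edges G) > 2 * h1 G"

definition log_divergent :: "'a ugraph \<Rightarrow> bool" where
  "log_divergent G \<longleftrightarrow> card (edges G) = 2 * h1 G"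

definition primitively_log_divergent :: "'a ugraph \<Rightarrow> bool" where
  "primitively_log_divergent G \<longleftrightarrow> log_divergent G \<and>
     (\<forall>H. subgraph H G \<and> connected_graph H \<and> edges H \<noteq> {} \<and> edges H \<subset> edges G \<longrightarrow>
        convergent_graph H)"

definition WS :: "nat \<Rightarrow> nat ugraph" where
  "WS n = \<lparr>verts = {0..n},
           edges = {{0, i} | i. 1 \<le> i \<and> i \<le> n} \<union>
                   {{i, i + 1} | i. 1 \<le> i \<and> i < n} \<union> {{n, 1}}\<rparr>"

definition ZZ5 :: "nat ugraph" where
  "ZZ5 = \<lparr>verts = {1..6},
          edges = {{i, i + 1} | i. 1 \<le> i \<and> i \<le> 5} \<union>
                  {{i, i + 2} | i. 1 \<le> i \<and> i \<le> 4} \<union> {{1, 6}}\<rparr>"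

definition XX5 :: "nat ugraph" where
  "XX5 = \<lparr>verts = {1..6},
          edges = {{i, j} | i j. i \<in> {1, 2} \<and> j \<in> {3, 4, 5, 6}} \<union> {{3, 4}, {5, 6}}\<rparr>"

definition ST5 :: "nat ugraph" where
  "ST5 = \<lparr>verts = {1..6},
          edges = {{1, 2}} \<union> {{i, j} | i j. i \<in> {1, 2, 6} \<and> j \<in> {3, 4, 5}}\<rparr>"

end

theory Submission
  imports Defs
begin

text \<open>
  A connected graph has \<open>h1 = |E| - |V| + 1\<close>, so a primitively log divergent graph with
  \<open>2 n\<close> edges has \<open>n + 1\<close> vertices, and deleting a vertex shows that every degree is at
  least \<open>3\<close>. Nothing else is needed: in the complement every degree is at most \<open>n - 3\<close>, and
  counting edges gives \<open>n \<ge> 3\<close>. For \<open>n = 3\<close> the complement is empty, for \<open>n = 4\<close> it is a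
  matching with two edges, and for \<open>n = 5\<close> it has five edges and maximal degree \<open>2\<close> on six
  vertices, hence it is \<open>C5 + K1\<close>, \<open>C4 + K2\<close>, \<open>C3 + P3\<close> or \<open>P6\<close>. These are the
  complements of \<open>WS 5\<close>, \<open>XX5\<close>, \<open>ST5\<close> and \<open>ZZ5\<close>.
\<close>

section \<open>Rank of subgroups of integer-valued functions\<close>

definition int_linear :: "(('b \<Rightarrow> int) \<Rightarrow> int) \<Rightarrow> bool" where
  "int_linear \<phi> \<longleftrightarrow> (\<forall>a b f g. \<phi> (\<lambda>x. a * f x + b * g x) = a * \<phi> f + b * \<phi> g)"

definition int_closed :: "('b \<Rightarrow> int) set \<Rightarrow> bool" where
  "int_closed A \<longleftrightarrow> (\<forall>a b. \<forall>f\<in>A. \<forall>g\<in>A. (\<lambda>x. a * f x + b * g x) \<in> A)"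

text \<open>Independence is attached to an index set rather than to a set of functions, so that
  elimination can replace members without tracking coincidences among them.\<close>

definition indep_family :: "'i set \<Rightarrow> ('i \<Rightarrow> 'b \<Rightarrow> int) \<Rightarrow> bool" where
  "indep_family I f \<longleftrightarrow> (\<forall>u. (\<forall>x. (\<Sum>i\<in>I. u i * f i x) = 0) \<longrightarrow> (\<forall>i\<in>I. u i = 0))"

lemma int_linearD: "int_linear \<phi> \<Longrightarrow> \<phi> (\<lambda>x. a * f x + b * g x) = a * \<phi> f + b * \<phi> g"
  by (simp add: int_linear_def)

lemma int_closedD: "int_closed A \<Longrightarrow> f \<in> A \<Longrightarrow> g \<in> A \<Longrightarrow> (\<lambda>x. a * f x + b * g x) \<in> A"
  by (simp add: int_closed_def)

lemma sum_fun_apply: "(\<Sum>i\<in>I. f i) x = (\<Sum>i\<in>I. f i x)" for f :: "'i \<Rightarrow> 'b \<Rightarrow> int"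
  by (induction I rule: infinite_finite_induct) auto

lemma int_linear_sum:
  assumes "int_linear \<phi>"
  shows "\<phi> (\<lambda>x. \<Sum>i\<in>I. u i * f i x) = (\<Sum>i\<in>I. u i * \<phi> (f i))"
proof (induction I rule: infinite_finite_induct)
  case (insert i I)
  have "\<phi> (\<lambda>x. u i * f i x + 1 * (\<Sum>i\<in>I. u i * f i x)) = u i * \<phi> (f i) + 1 * \<phi> (\<lambda>x. \<Sum>i\<in>I. u i * f i x)"
    using assms by (rule int_linearD)
  with insert show ?case by simp
qed (use int_linearD[OF assms, of 0 _ 0] in auto)

lemma independent_iff_indep_family:
  assumes "finite B"
  shows "int_fun.independent B \<longleftrightarrow> indep_family B id"
proof -
  have "(\<Sum>b\<in>B. (\<lambda>x. u b * b x)) = 0 \<longleftrightarrow> (\<forall>x. (\<Sum>b\<in>B. u b * id b x) = 0)" for u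
    by (simp only: fun_eq_iff sum_fun_apply zero_fun_def id_apply)
  thus ?thesis
    unfolding int_fun.dependent_finite[OF assms] indep_family_def by blast
qed

text \<open>Equal members at two distinct indices would satisfy the relation with coefficients 1 and
  -1.\<close>

lemma indep_family_inj_on:
  assumes "finite I" "indep_family I f"
  shows "inj_on f I"
proof (rule inj_onI, rule ccontr)
  fix i j assume ij: "i \<in> I" "j \<in> I" "f i = f j" "i \<noteq> j"
  define u :: "_ \<Rightarrow> int" where "u k = (if k = i then 1 else 0) - (if k = j then 1 else 0)" for k
  have "(\<Sum>k\<in>I. u k * f k x) = 0" for x
    using ij assms(1) by (simp add: u_def left_diff_distrib sum_subtractf if_distrib[of "\<lambda>a. a * _"] cong: if_cong)
  hence "u i = 0" using assms(2) ij unfolding indep_family_def by blast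
  thus False using ij by (simp add: u_def)
qed

lemma indep_family_image:
  assumes "finite I" "indep_family I f"
  shows "int_fun.independent (f ` I)" "card (f ` I) = card I"
proof -
  note inj = indep_family_inj_on[OF assms]
  show "card (f ` I) = card I" using inj by (rule card_image)
  have "indep_family (f ` I) id"
    unfolding indep_family_def
  proof (intro allI impI ballI)
    fix u b assume "\<forall>x. (\<Sum>i\<in>f ` I. u i * id i x) = 0" and b: "b \<in> f ` I"
    hence "\<forall>x. (\<Sum>i\<in>I. (u \<circ> f) i * f i x) = 0" by (simp add: sum.reindex[OF inj])
    with assms(2) have "\<forall>i\<in>I. (u \<circ> f) i = 0" unfolding indep_family_def by blast
    with b show "u b = 0" by auto
  qed
  thus "int_fun.independent (f ` I)"
    using assms(1) by (simp add: independent_iff_indep_family)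
qed

text \<open>\<open>Max\<close> is informative only on a finite nonempty set: the bound makes the set
  of sizes finite, and the empty family makes it nonempty.\<close>

lemma int_rank_le:
  assumes "\<And>B. finite B \<Longrightarrow> indep_family B id \<Longrightarrow> B \<subseteq> A \<Longrightarrow> card B \<le> m"
  shows "int_rank A \<le> m"
proof -
  let ?S = "{card B | B. finite B \<and> B \<subseteq> A \<and> int_fun.independent B}"
  have le: "\<forall>k\<in>?S. k \<le> m" using assms by (auto simp: independent_iff_indep_family)
  hence "finite ?S" by (meson finite_nat_set_iff_bounded_le)
  moreover have "card ({} :: ('a \<Rightarrow> int) set) \<in> ?S"
    using int_fun.independent_empty by blast
  ultimately show ?thesis unfolding int_rank_def using le by (subst Max_le_iff) auto
qed

text \<open>The a priori bound \<open>m\<close> makes the set of sizes finite, so that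
  \<open>Max\<close> dominates the size contributed by the image of the family.\<close>

lemma int_rank_ge:
  assumes "\<And>B. finite B \<Longrightarrow> indep_family B id \<Longrightarrow> B \<subseteq> A \<Longrightarrow> card B \<le> m"
    and "finite I" "indep_family I f" "f ` I \<subseteq> A"
  shows "card I \<le> int_rank A"
proof -
  let ?S = "{card B | B. finite B \<and> B \<subseteq> A \<and> int_fun.independent B}"
  have "\<forall>k\<in>?S. k \<le> m" using assms(1) by (auto simp: independent_iff_indep_family)
  hence "finite ?S" by (meson finite_nat_set_iff_bounded_le)
  moreover have "card I \<in> ?S"
    using indep_family_image[OF assms(2,3)] assms(2,4) by (metis (mono_tags, lifting) finite_imageI mem_Collect_eq)
  ultimately show ?thesis unfolding int_rank_def by simp
qed

text \<open>
  Integer version of elimination: if \<open>\<phi> (f k) \<noteq> 0\<close>, the combinations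
  \<open>\<phi> (f k) * f i - \<phi> (f i) * f k\<close> with \<open>i \<noteq> k\<close> lie in the kernel and stay independent.
\<close>

lemma indep_family_kernel:
  fixes f :: "'i \<Rightarrow> 'b \<Rightarrow> int"
  assumes "int_linear \<phi>" "int_closed A" "finite I" "indep_family I f" "f ` I \<subseteq> A"
  shows "\<exists>J g. finite J \<and> card I \<le> card J + 1 \<and> indep_family (J :: 'i set) g \<and> g ` J \<subseteq> A \<and> (\<forall>j\<in>J. \<phi> (g j) = 0)"
proof (cases "\<forall>i\<in>I. \<phi> (f i) = 0")
  case True
  thus ?thesis using assms by (intro exI[of _ I] exI[of _ f]) auto
next
  case False
  then obtain k where k: "k \<in> I" "\<phi> (f k) \<noteq> 0" by blast
  define g where "g i = (\<lambda>x. \<phi> (f k) * f i x + (- \<phi> (f i)) * f k x)" for i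
  have "\<phi> (g i) = 0" for i
    unfolding g_def int_linearD[OF assms(1)] by simp
  moreover have "g ` (I - {k}) \<subseteq> A"
    using assms(5) k unfolding g_def by (blast intro: int_closedD[OF assms(2)])
  moreover have "indep_family (I - {k}) g"
    unfolding indep_family_def
  proof (intro allI impI ballI)
    fix u i assume u: "\<forall>x. (\<Sum>i\<in>I - {k}. u i * g i x) = 0" and i: "i \<in> I - {k}"
    \<comment> \<open>Coefficients of the relation among the \<open>f i\<close> that results from
      expanding each \<open>g i\<close>; all multiples of \<open>f k\<close> are collected at
      \<open>k\<close>.\<close>
    define w where "w i = (if i = k then - (\<Sum>i\<in>I - {k}. u i * \<phi> (f i)) else u i * \<phi> (f k))" for i
    have "(\<Sum>i\<in>I. w i * f i x) = 0" for x
    proof -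
      have "(\<Sum>i\<in>I. w i * f i x) = w k * f k x + (\<Sum>i\<in>I - {k}. w i * f i x)"
        using k assms(3) by (simp add: sum.remove)
      also have "(\<Sum>i\<in>I - {k}. w i * f i x) = (\<Sum>i\<in>I - {k}. u i * \<phi> (f k) * f i x)"
        by (rule sum.cong) (auto simp: w_def)
      also have "w k * f k x = - (\<Sum>i\<in>I - {k}. u i * \<phi> (f i) * f k x)"
        by (simp add: w_def sum_distrib_right)
      finally have "(\<Sum>i\<in>I. w i * f i x) = (\<Sum>i\<in>I - {k}. u i * g i x)"
        by (simp add: g_def algebra_simps sum_subtractf)
      thus ?thesis using u by simp
    qed
    hence "w i = 0" using assms(4) i unfolding indep_family_def by blast
    \<comment> \<open>Here \<open>w i = u i * \<phi> (f k)\<close>, and the nonzero integer factor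
      cancels.\<close>
    thus "u i = 0" using i k by (simp add: w_def)
  qed
  moreover have "card I \<le> card (I - {k}) + 1" using k assms(3) by simp
  ultimately show ?thesis using assms(3) by (intro exI[of _ "I - {k}"] exI[of _ g]) auto
qed

text \<open>Eliminating with one functional at a time loses at most one member per
  functional.\<close>

lemma indep_family_kernels:
  fixes f :: "'i \<Rightarrow> 'b \<Rightarrow> int"
  assumes "finite S" "\<And>s. s \<in> S \<Longrightarrow> int_linear (\<phi> s)"
    and "int_closed A" "finite I" "indep_family I f" "f ` I \<subseteq> A"
  shows "\<exists>J g. finite J \<and> card I \<le> card J + card S \<and> indep_family (J :: 'i set) g \<and> g ` J \<subseteq> A \<and>
    (\<forall>j\<in>J. \<forall>s\<in>S. \<phi> s (g j) = 0)"
  using assms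
proof (induction S rule: finite_induct)
  case empty
  thus ?case by (intro exI[of _ I] exI[of _ f]) auto
next
  case (insert s S)
  have "\<exists>J g. finite J \<and> card I \<le> card J + card S \<and> indep_family (J :: 'i set) g \<and> g ` J \<subseteq> A \<and>
    (\<forall>j\<in>J. \<forall>s\<in>S. \<phi> s (g j) = 0)"
    by (rule insert.IH) (use insert.prems in auto)
  then obtain J g where J: "finite J" "card I \<le> card J + card S" "indep_family (J :: 'i set) g"
    "g ` J \<subseteq> A" "\<forall>j\<in>J. \<forall>s\<in>S. \<phi> s (g j) = 0" by blast
  \<comment> \<open>Working inside the common kernel of the functionals in \<open>S\<close> keeps
    them zero while \<open>s\<close> is eliminated.\<close>
  let ?A = "{c \<in> A. \<forall>s\<in>S. \<phi> s c = 0}"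
  have lin: "\<phi> t (\<lambda>x. a * c x + b * d x) = a * \<phi> t c + b * \<phi> t d" if "t \<in> S" for t a b c d
    by (rule int_linearD) (use insert.prems(1)[of t] that in simp)
  have "int_closed ?A"
    using \<open>int_closed A\<close> unfolding int_closed_def by (auto simp: lin)
  moreover have "g ` J \<subseteq> ?A" using J by blast
  ultimately obtain K h where "finite K" "card J \<le> card K + 1" "indep_family (K :: 'i set) h" "h ` K \<subseteq> ?A"
    "\<forall>j\<in>K. \<phi> s (h j) = 0"
    using indep_family_kernel[of "\<phi> s" ?A J g] insert.prems(1)[of s] J by blast
  thus ?case using J insert.hyps by (intro exI[of _ K] exI[of _ h]) auto
qed

text \<open>Making every coordinate \<open>p s\<close> vanish costs at most \<open>card S\<close>
  members. Whatever survives is zero, and an independent family of zero functions is empty.\<close>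

lemma card_indep_family_le_coordinates:
  fixes f :: "'i \<Rightarrow> 'b \<Rightarrow> int"
  assumes "finite S" "int_closed A" "\<And>c. c \<in> A \<Longrightarrow> (\<And>s. s \<in> S \<Longrightarrow> c (p s) = 0) \<Longrightarrow> c = (\<lambda>x. 0)"
    and "finite I" "indep_family I f" "f ` I \<subseteq> A"
  shows "card I \<le> card S"
proof -
  obtain J g where J: "finite J" "card I \<le> card J + card S" "indep_family (J :: 'i set) g"
    "g ` J \<subseteq> A" "\<forall>j\<in>J. \<forall>s\<in>S. g j (p s) = 0"
    using indep_family_kernels[of S "\<lambda>s c. c (p s)" A I f, OF assms(1) _ assms(2,4,5,6)] by (auto simp: int_linear_def)
  have "\<forall>j\<in>J. g j = (\<lambda>x. 0)" using J assms(3) by blast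
  hence "J = {}"
    using J(3)[unfolded indep_family_def, rule_format, of "\<lambda>_. 1"] by auto
  with J show ?thesis by simp
qed

section \<open>The first Betti number of a graph\<close>

lemma simple_graph_edgeD:
  assumes "simple_graph G" "{u, v} \<in> edges G"
  shows "u \<in> verts G" "v \<in> verts G" "u \<noteq> v"
proof -
  obtain a b where "a \<in> verts G" "b \<in> verts G" "a \<noteq> b" "{u, v} = {a, b}"
    using assms unfolding simple_graph_def by metis
  thus "u \<in> verts G" "v \<in> verts G" "u \<noteq> v" by (auto simp: doubleton_eq_iff)
qed

lemma finite_edges:
  assumes "simple_graph G"
  shows "finite (edges G)"
proof (rule finite_subset)
  show "edges G \<subseteq> Pow (verts G)" using assms unfolding simple_graph_def by auto
  show "finite (Pow (verts G))" using assms unfolding simple_graph_def by auto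
qed

section \<open>Integer chains and their boundaries\<close>

lemma int_closed_chains1: "int_closed (chains1 G)"
  unfolding int_closed_def
proof (intro allI ballI)
  fix a b f g assume fg: "f \<in> chains1 G" "g \<in> chains1 G"
  have "a * f (v, u) + b * g (v, u) = - (a * f (u, v) + b * g (u, v))" for u v
  proof -
    have "f (v, u) = - f (u, v)" "g (v, u) = - g (u, v)" using fg unfolding chains1_def by blast+
    thus ?thesis by simp
  qed
  moreover have "a * f (u, v) + b * g (u, v) = 0" if "{u, v} \<notin> edges G" for u v
  proof -
    have "f (u, v) = 0" "g (u, v) = 0" using fg that unfolding chains1_def by blast+
    thus ?thesis by simp
  qed
  ultimately show "(\<lambda>x. a * f x + b * g x) \<in> chains1 G" unfolding chains1_def by blast
qed

lemma int_linear_boundary1: "int_linear (\<lambda>c. boundary1 G c v)"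
  unfolding int_linear_def boundary1_def by (simp add: sum.distrib sum_distrib_left)

text \<open>Swapping the two summations and using antisymmetry shows that the sum equals its own
  negative.\<close>

lemma sum_boundary1:
  assumes "c \<in> chains1 G"
  shows "(\<Sum>v\<in>verts G. boundary1 G c v) = 0"
proof -
  have "(\<Sum>v\<in>verts G. boundary1 G c v) = (\<Sum>v\<in>verts G. \<Sum>u\<in>verts G. c (u, v))"
    by (simp add: boundary1_def)
  also have "\<dots> = (\<Sum>v\<in>verts G. \<Sum>u\<in>verts G. c (v, u))" by (rule sum.swap)
  also have "\<dots> = (\<Sum>v\<in>verts G. \<Sum>u\<in>verts G. - c (u, v))"
    using assms unfolding chains1_def by (intro sum.cong refl) blast
  finally show ?thesis by (simp add: boundary1_def sum_negf)
qed

text \<open>The generator given by the oriented edge from \<open>a\<close> to \<open>b\<close>; the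
  second indicator is forced by the antisymmetry of chains.\<close>

definition edge_chain :: "'a \<Rightarrow> 'a \<Rightarrow> 'a \<times> 'a \<Rightarrow> int" where
  "edge_chain a b x = of_bool (x = (a, b)) - of_bool (x = (b, a))"

lemma edge_chain_in_chains1:
  assumes "{a, b} \<in> edges G"
  shows "edge_chain a b \<in> chains1 G"
proof -
  have "edge_chain a b (v, u) = - edge_chain a b (u, v)" for u v
    by (simp add: edge_chain_def conj_commute)
  moreover have "edge_chain a b (u, v) = 0" if "{u, v} \<notin> edges G" for u v
  proof -
    have "(u, v) \<noteq> (a, b)" "(u, v) \<noteq> (b, a)" using that assms by (auto simp: insert_commute)
    thus ?thesis unfolding edge_chain_def by (simp only: of_bool_eq diff_self)
  qed
  ultimately show ?thesis unfolding chains1_def by blast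
qed

lemma boundary1_edge_chain:
  assumes "simple_graph G" "{a, b} \<in> edges G"
  shows "boundary1 G (edge_chain a b) w = (if w = b then 1 else 0) - (if w = a then 1 else 0)"
proof -
  have "finite (verts G)" using assms(1) by (simp add: simple_graph_def)
  thus ?thesis using simple_graph_edgeD[OF assms]
    by (cases "w = a"; cases "w = b") (simp_all add: boundary1_def edge_chain_def of_bool_def sum_subtractf sum_negf)
qed

text \<open>Chains carry no preferred orientation; choosing one per edge provides coordinates and
  generators indexed by the edges.\<close>

lemma obtain_orientation:
  assumes "simple_graph G"
  obtains s t where "\<And>e. e \<in> edges G \<Longrightarrow> e = {s e, t e}" "\<And>e. e \<in> edges G \<Longrightarrow> s e \<noteq> t e"
  using assms unfolding simple_graph_def by metis

text \<open>A chain is determined by its values on one orientation of each edge: antisymmetry gives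
  the other orientation, and off the edges it vanishes.\<close>

lemma card_indep_family_chains1:
  assumes "simple_graph G" "finite I" "indep_family I f" "f ` I \<subseteq> chains1 G"
  shows "card I \<le> card (edges G)"
proof -
  obtain s t where st: "\<And>e. e \<in> edges G \<Longrightarrow> e = {s e, t e}" "\<And>e. e \<in> edges G \<Longrightarrow> s e \<noteq> t e"
    using obtain_orientation[OF assms(1)] by blast
  show ?thesis
  proof (rule card_indep_family_le_coordinates[where p = "\<lambda>e. (s e, t e)"])
    fix c assume c: "c \<in> chains1 G" and 0: "\<And>e. e \<in> edges G \<Longrightarrow> c (s e, t e) = 0"
    show "c = (\<lambda>x. 0)"
    proof
      fix x :: "'a \<times> 'a" obtain u v where x: "x = (u, v)" by force
      have c1: "c (t e, s e) = - c (s e, t e)" for e using c unfolding chains1_def by blast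
      show "c x = 0"
      proof (cases "{u, v} \<in> edges G")
        case True
        hence "x = (s {u, v}, t {u, v}) \<or> x = (t {u, v}, s {u, v})"
          using st(1)[OF True] x by (auto simp: doubleton_eq_iff)
        thus ?thesis using 0[OF True] c1[of "{u, v}"] by auto
      next
        case False
        thus ?thesis using c x unfolding chains1_def by blast
      qed
    qed
  qed (use assms finite_edges int_closed_chains1 in auto)
qed

lemma card_indep_family_H1:
  assumes "simple_graph G" "finite I" "indep_family I f" "f ` I \<subseteq> H1 G"
  shows "card I \<le> card (edges G)"
  using card_indep_family_chains1[OF assms(1-3)] assms(4) by (auto simp: H1_def)

text \<open>
  Starting from one chain per edge, each of the \<open>|V| - 1\<close> boundary conditions away from a root costs
  at most one dimension; the condition at the root follows, as the boundary has coefficient sum zero.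
\<close>

lemma h1_lower_bound:
  assumes "simple_graph G" "verts G \<noteq> {}"
  shows "card (edges G) + 1 \<le> h1 G + card (verts G)"
proof -
  obtain s t where st: "\<And>e. e \<in> edges G \<Longrightarrow> e = {s e, t e}" "\<And>e. e \<in> edges G \<Longrightarrow> s e \<noteq> t e"
    using obtain_orientation[OF assms(1)] by blast
  obtain r where r: "r \<in> verts G" using assms by blast
  have finV: "finite (verts G)" using assms by (simp add: simple_graph_def)
  have finE: "finite (edges G)" using finite_edges assms by blast
  define f where "f e = edge_chain (s e) (t e)" for e
  have "indep_family (edges G) f"
    unfolding indep_family_def
  proof (intro allI impI ballI)
    fix u :: "'a set \<Rightarrow> int" and e
    assume 0: "\<forall>x. (\<Sum>e\<in>edges G. u e * f e x) = 0" and e: "e \<in> edges G"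
    \<comment> \<open>Only the generator of \<open>e\<close> is nonzero at
      \<open>(s e, t e)\<close>, so evaluating the relation there isolates \<open>u e\<close>;
      \<open>s e \<noteq> t e\<close> keeps its two indicators from cancelling.\<close>
    have "f d (s e, t e) = (if d = e then 1 else 0)" if d: "d \<in> edges G" for d
    proof (cases "d = e")
      case False
      hence "{s e, t e} \<noteq> {s d, t d}"
        unfolding st(1)[OF d, symmetric] st(1)[OF e, symmetric] by blast
      hence "(s e, t e) \<noteq> (s d, t d)" "(s e, t e) \<noteq> (t d, s d)"
        by (auto simp: doubleton_eq_iff)
      thus ?thesis using False unfolding f_def edge_chain_def by (simp only: of_bool_eq if_False diff_self)
    qed (use st(2)[OF e] in \<open>simp add: f_def edge_chain_def\<close>)
    hence "(\<Sum>d\<in>edges G. u d * f d (s e, t e)) = (\<Sum>d\<in>edges G. if d = e then u d else 0)"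
      by (intro sum.cong) auto
    with 0 e finE show "u e = 0" by simp
  qed
  moreover have "f ` edges G \<subseteq> chains1 G"
  proof (rule image_subsetI)
    fix e assume "e \<in> edges G"
    thus "f e \<in> chains1 G"
      unfolding f_def by (intro edge_chain_in_chains1) (simp only: st(1)[symmetric])
  qed
  ultimately obtain J g where J: "finite J" "card (edges G) \<le> card J + card (verts G - {r})"
    "indep_family (J :: 'a set set) g" "g ` J \<subseteq> chains1 G"
    "\<forall>j\<in>J. \<forall>v\<in>verts G - {r}. boundary1 G (g j) v = 0"
    using indep_family_kernels[of "verts G - {r}" "\<lambda>v c. boundary1 G c v" "chains1 G" "edges G" f,
        OF finite_Diff[OF finV] int_linear_boundary1 int_closed_chains1 finE] by blast
  have "g j \<in> H1 G" if j: "j \<in> J" for j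
  proof -
    have "boundary1 G (g j) r = 0"
      using sum_boundary1[of "g j" G] J(4,5) j sum.remove[OF finV r, of "boundary1 G (g j)"] by auto
    thus ?thesis using J j by (auto simp: H1_def)
  qed
  hence "card J \<le> h1 G" unfolding h1_def
    using J by (intro int_rank_ge[where m = "card (edges G)"] card_indep_family_H1[where f = id] assms) auto
  thus ?thesis using J(2) card.remove[OF finV r] by linarith
qed

text \<open>Adding the generators of the successive edges of a path telescopes the boundary to end
  minus start.\<close>

lemma path_chain_exists:
  assumes "simple_graph G" "(r, v) \<in> {(x, y). {x, y} \<in> edges G}\<^sup>*"
  shows "\<exists>c\<in>chains1 G. \<forall>w. boundary1 G c w = (if w = v then 1 else 0) - (if w = r then 1 else 0)"
  using assms(2)
proof (induction rule: rtrancl_induct)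
  case base
  show ?case by (rule bexI[of _ "\<lambda>x. 0"]) (auto simp: boundary1_def chains1_def)
next
  case (step y z)
  then obtain c where c: "c \<in> chains1 G"
    "\<And>w. boundary1 G c w = (if w = y then 1 else 0) - (if w = r then 1 else 0)" by blast
  have yz: "{y, z} \<in> edges G" using step by simp
  let ?d = "\<lambda>x. 1 * c x + 1 * edge_chain y z x"
  have "?d \<in> chains1 G"
    by (rule int_closedD[OF int_closed_chains1 c(1) edge_chain_in_chains1[OF yz]])
  moreover have "boundary1 G ?d w = 1 * boundary1 G c w + 1 * boundary1 G (edge_chain y z) w" for w
    by (rule int_linearD[OF int_linear_boundary1])
  hence "\<forall>w. boundary1 G ?d w = (if w = z then 1 else 0) - (if w = r then 1 else 0)"
    using c(2) boundary1_edge_chain[OF assms(1) yz] by simp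
  ultimately show ?case by blast
qed

text \<open>
  Paths from a root to the other vertices, added to an independent family of cycles, keep it
  independent, since only the path to \<open>v\<close> has a nonzero boundary at \<open>v\<close>.
\<close>

lemma h1_upper_bound:
  assumes "simple_graph G" "connected_graph G"
  shows "h1 G + card (verts G) \<le> card (edges G) + 1"
proof -
  have finV: "finite (verts G)" using assms by (simp add: simple_graph_def)
  obtain r where r: "r \<in> verts G" using assms by (auto simp: connected_graph_def)
  define V where "V = verts G - {r}"
  have "\<forall>v\<in>V. \<exists>c\<in>chains1 G. \<forall>w. boundary1 G c w = (if w = v then 1 else 0) - (if w = r then 1 else 0)"
    using path_chain_exists[OF assms(1)] assms(2) r by (simp add: connected_graph_def V_def)
  then obtain P where P: "\<And>v. v \<in> V \<Longrightarrow> P v \<in> chains1 G"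
    "\<And>v w. v \<in> V \<Longrightarrow> boundary1 G (P v) w = (if w = v then 1 else 0) - (if w = r then 1 else 0)" by metis
  have finV': "finite V" using finV by (simp add: V_def)
  have "card B + card V \<le> card (edges G)" if B: "finite B" "indep_family B id" "B \<subseteq> H1 G" for B
  proof -
    \<comment> \<open>A disjoint sum of index sets joins cycles and paths without first proving them
      distinct as functions.\<close>
    let ?f = "case_sum id P"
    have "indep_family (B <+> V) ?f"
      unfolding indep_family_def
    proof (intro allI impI)
      fix u :: "_ \<Rightarrow> int" assume 0: "\<forall>x. (\<Sum>i\<in>B <+> V. u i * ?f i x) = 0"
      have split: "(\<Sum>i\<in>B <+> V. u i * h i) = (\<Sum>b\<in>B. u (Inl b) * h (Inl b)) + (\<Sum>v\<in>V. u (Inr v) * h (Inr v))" for h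
        using B(1) finV' by (simp add: sum.Plus)
      have "u (Inr v) = 0" if v: "v \<in> V" for v
      proof -
        have lin: "int_linear (\<lambda>c. boundary1 G c v)" by (rule int_linear_boundary1)
        \<comment> \<open>The boundary at \<open>v\<close> kills the cycles and every path chain
          except \<open>P v\<close>; the root lies outside \<open>V\<close>, so its -1 never
          appears.\<close>
        have "0 = boundary1 G (\<lambda>x. \<Sum>i\<in>B <+> V. u i * ?f i x) v"
          using 0 by (simp add: boundary1_def)
        also have "\<dots> = (\<Sum>i\<in>B <+> V. u i * boundary1 G (?f i) v)"
          by (rule int_linear_sum[OF lin])
        also have "\<dots> = (\<Sum>b\<in>B. u (Inl b) * boundary1 G b v) + (\<Sum>w\<in>V. u (Inr w) * boundary1 G (P w) v)"
          by (simp add: split)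
        also have "(\<Sum>b\<in>B. u (Inl b) * boundary1 G b v) = 0"
          using B v by (intro sum.neutral) (auto simp: H1_def V_def)
        also have "(\<Sum>w\<in>V. u (Inr w) * boundary1 G (P w) v) = (\<Sum>w\<in>V. if w = v then u (Inr w) else 0)"
          using v by (intro sum.cong) (auto simp: P V_def)
        finally show ?thesis using v finV' by simp
      qed
      moreover from this have "\<forall>x. (\<Sum>b\<in>B. (u \<circ> Inl) b * id b x) = 0"
        using 0 by (simp add: split)
      hence "\<forall>b\<in>B. (u \<circ> Inl) b = 0" using B(2) unfolding indep_family_def by blast
      ultimately show "\<forall>i\<in>B <+> V. u i = 0" by auto
    qed
    moreover have "?f ` (B <+> V) \<subseteq> chains1 G" using B(3) P by (auto simp: H1_def)
    ultimately have "card (B <+> V) \<le> card (edges G)"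
      using B(1) finV' by (intro card_indep_family_chains1[OF assms(1)]) simp_all
    thus ?thesis using B finV' by (simp add: card_Plus)
  qed
  note bound = this
  \<comment> \<open>Taking no cycles gives this inequality, which keeps the truncated subtraction
    below from losing information.\<close>
  have "card V \<le> card (edges G)" using bound[of "{}"] by (simp add: indep_family_def)
  moreover have "h1 G \<le> card (edges G) - card V"
    unfolding h1_def using bound by (intro int_rank_le) (metis add_le_imp_le_diff)
  moreover have "card (verts G) = card V + 1" using card.remove[OF finV r] by (simp add: V_def)
  ultimately show ?thesis by simp
qed

section \<open>Degrees in a primitively log divergent graph\<close>

text \<open>
  Primitivity speaks about connected subgraphs only; deleting a vertex may disconnect the graph, so
  the bound is extended to disconnected subgraphs by adding it up over the parts.
\<close>

lemma proper_edge_subset_sparse: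
  assumes G: "simple_graph G" "primitively_log_divergent G"
    and "W \<subseteq> verts G" "W \<noteq> {}" "F \<subset> edges G" "\<And>e. e \<in> F \<Longrightarrow> e \<subseteq> W"
  shows "card F + 2 \<le> 2 * card W \<and> (F \<noteq> {} \<longrightarrow> card F + 3 \<le> 2 * card W)"
  using assms(3-)
proof (induction "card W" arbitrary: W F rule: less_induct)
  case less
  have finV: "finite (verts G)" using G by (simp add: simple_graph_def)
  have finW: "finite W" using finV less.prems by (blast intro: finite_subset)
  have finF: "finite F" using finite_edges[OF G(1)] less.prems by (blast intro: finite_subset)
  define H where "H = \<lparr>verts = W, edges = F\<rparr>"
  have ends: "\<exists>u\<in>W. \<exists>v\<in>W. u \<noteq> v \<and> e = {u, v}" if e: "e \<in> F" for e
  proof -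
    have "e \<in> edges G" using e less.prems(3) by blast
    then obtain u v where "u \<noteq> v" "e = {u, v}" using G(1) unfolding simple_graph_def by metis
    thus ?thesis using less.prems(4)[OF e] by blast
  qed
  have simple: "simple_graph H" using ends finW by (simp add: simple_graph_def H_def)
  consider "F = {}" | "F \<noteq> {}" "connected_graph H" | "F \<noteq> {}" "\<not> connected_graph H" by blast
  thus ?case
  proof cases
    case 1
    \<comment> \<open>Without edges only the weaker bound holds: a single vertex attains it.\<close>
    have "card W \<noteq> 0" using finW less.prems by simp
    with 1 show ?thesis by simp
  next
    case 2
    have "subgraph H G" using simple less.prems by (auto simp: subgraph_def H_def)
    hence "convergent_graph H"
      using G(2) 2 less.prems(3) by (simp add: primitively_log_divergent_def H_def)
    \<comment> \<open>Inserting \<open>h1 H \<ge> |F| + 1 - |W|\<close> into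
      \<open>|F| > 2 * h1 H\<close> gives \<open>|F| + 3 \<le> 2 * |W|\<close>.\<close>
    moreover have "card (edges H) + 1 \<le> h1 H + card (verts H)"
      by (rule h1_lower_bound[OF simple]) (use less.prems in \<open>simp add: H_def\<close>)
    ultimately show ?thesis by (simp add: H_def convergent_graph_def)
  next
    case 3
    let ?R = "{(x, y). {x, y} \<in> F}"
    obtain u w where uw: "u \<in> W" "w \<in> W" "(u, w) \<notin> ?R\<^sup>*"
      using 3 less.prems by (auto simp: connected_graph_def H_def)
    \<comment> \<open>\<open>A\<close> is the component of \<open>u\<close>: no edge of
      \<open>F\<close> joins it to \<open>W - A\<close>. Both parts are nonempty, because of
      \<open>u\<close> and \<open>w\<close>, hence smaller than \<open>W\<close>.\<close>
    define A where "A = {x \<in> W. (u, x) \<in> ?R\<^sup>*}"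
    define F1 where "F1 = {e \<in> F. e \<subseteq> A}"
    define F2 where "F2 = {e \<in> F. e \<subseteq> W - A}"
    have A: "u \<in> A" "w \<notin> A" "A \<subseteq> W" using uw by (auto simp: A_def)
    have "e \<in> F1 \<or> e \<in> F2" if e: "e \<in> F" for e
    proof -
      obtain x y where xy: "x \<in> W" "y \<in> W" "e = {x, y}" using ends[OF e] by blast
      have "(x, y) \<in> ?R" "(y, x) \<in> ?R" using e xy by (auto simp: insert_commute)
      hence "x \<in> A \<longleftrightarrow> y \<in> A" using xy unfolding A_def by (blast intro: rtrancl_into_rtrancl)
      thus ?thesis using xy e by (auto simp: F1_def F2_def)
    qed
    hence F: "F = F1 \<union> F2" by (auto simp: F1_def F2_def)
    have "e \<noteq> {}" if "e \<in> F" for e using ends[OF that] by blast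
    hence "F1 \<inter> F2 = {}" by (auto simp: F1_def F2_def)
    hence cF: "card F = card F1 + card F2" using F finF by (simp add: card_Un_disjoint)
    have cW: "card W = card A + card (W - A)"
      using A finW by (metis card_Diff_subset card_mono finite_subset le_add_diff_inverse)
    have lt: "card A < card W" "card (W - A) < card W"
      using A uw finW by (auto intro!: psubset_card_mono)
    have "F1 \<subset> edges G" "F2 \<subset> edges G" using less.prems(3) F by blast+
    \<comment> \<open>The weak bounds of the two parts add up to
      \<open>card F + 4 \<le> 2 * card W\<close>.\<close>
    have "card F1 + 2 \<le> 2 * card A"
      by (rule less.hyps[OF lt(1), THEN conjunct1])
        (use A less.prems(1) \<open>F1 \<subset> edges G\<close> F1_def in blast)+
    moreover have "card F2 + 2 \<le> 2 * card (W - A)"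
      by (rule less.hyps[OF lt(2), THEN conjunct1])
        (use A uw less.prems(1) \<open>F2 \<subset> edges G\<close> F2_def in blast)+
    ultimately show ?thesis using cF cW by simp
  qed
qed

section \<open>Degrees in the graph and in its complement\<close>

definition incident :: "'a ugraph \<Rightarrow> 'a \<Rightarrow> 'a set set" where
  "incident G v = {e \<in> edges G. v \<in> e}"

text \<open>The neighbourhood of \<open>v\<close> in the complement graph.\<close>

definition nonneighbours :: "'a ugraph \<Rightarrow> 'a \<Rightarrow> 'a set" where
  "nonneighbours G v = {u \<in> verts G. u \<noteq> v \<and> {u, v} \<notin> edges G}"

lemma handshake:
  assumes "simple_graph G"
  shows "(\<Sum>v\<in>verts G. card (incident G v)) = 2 * card (edges G)"
proof -
  have fin: "finite (verts G)" "finite (edges G)"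
    using assms finite_edges by (auto simp: simple_graph_def)
  have "card {v \<in> verts G. v \<in> e} = 2" if e: "e \<in> edges G" for e
  proof -
    obtain u v where uv: "u \<in> verts G" "v \<in> verts G" "u \<noteq> v" "e = {u, v}"
      using assms e unfolding simple_graph_def by blast
    hence "{v \<in> verts G. v \<in> e} = {u, v}" by auto
    thus ?thesis using uv by simp
  qed
  hence "(\<Sum>v\<in>verts G. card {e \<in> edges G. v \<in> e}) = 2 * card (edges G)"
    using fin by (intro sum_multicount) auto
  thus ?thesis by (simp add: incident_def)
qed

text \<open>Edges at \<open>v\<close> correspond to its neighbours, and the vertices split into
  \<open>v\<close>, its neighbours and its nonneighbours.\<close>

lemma card_nonneighbours:
  assumes "simple_graph G" "v \<in> verts G"
  shows "card (nonneighbours G v) + card (incident G v) + 1 = card (verts G)"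
proof -
  have fin: "finite (verts G)" using assms by (simp add: simple_graph_def)
  define N where "N = {u \<in> verts G. {u, v} \<in> edges G}"
  have "incident G v = (\<lambda>u. {u, v}) ` N"
  proof (intro equalityI subsetI)
    fix e assume e: "e \<in> incident G v"
    then obtain a b where ab: "a \<in> verts G" "b \<in> verts G" "e = {a, b}"
      using assms(1) unfolding simple_graph_def incident_def by blast
    hence "v = a \<or> v = b" using e by (auto simp: incident_def)
    thus "e \<in> (\<lambda>u. {u, v}) ` N" using ab e by (auto simp: N_def incident_def insert_commute)
  qed (auto simp: N_def incident_def)
  moreover have "inj_on (\<lambda>u. {u, v}) N" by (auto simp: inj_on_def doubleton_eq_iff)
  ultimately have "card (incident G v) = card N" by (simp add: card_image)
  moreover have "card (verts G) = card (insert v (nonneighbours G v \<union> N))"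
    by (rule arg_cong[where f = card]) (use assms(2) in \<open>auto simp: nonneighbours_def N_def\<close>)
  moreover have "v \<notin> nonneighbours G v \<union> N"
    using simple_graph_edgeD(3)[OF assms(1), of v v] by (auto simp: nonneighbours_def N_def)
  moreover have "nonneighbours G v \<inter> N = {}" by (auto simp: nonneighbours_def N_def)
  moreover have "finite (nonneighbours G v)" "finite N" using fin by (simp_all add: nonneighbours_def N_def)
  ultimately show ?thesis by (simp add: card_Un_disjoint)
qed

lemma primitive_nonneighbours:
  assumes G: "graph G" "primitively_log_divergent G" "card (edges G) = 2 * n"
  shows "card (verts G) = n + 1" "n \<ge> 3"
    and "\<And>v. v \<in> verts G \<Longrightarrow> card (nonneighbours G v) + 3 \<le> n"
    and "(\<Sum>v\<in>verts G. card (nonneighbours G v)) + 4 * n = n * (n + 1)"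
proof -
  have simple: "simple_graph G" and conn: "connected_graph G" and "edges G \<noteq> {}"
    using G by (auto simp: graph_def)
  have fin: "finite (verts G)" "finite (edges G)"
    using simple finite_edges by (auto simp: simple_graph_def)
  have "n > 0" using G(3) fin \<open>edges G \<noteq> {}\<close> by (metis card_gt_0_iff mult_0_right gr0I less_irrefl)
  have "h1 G = n" using G by (simp add: primitively_log_divergent_def log_divergent_def)
  \<comment> \<open>The two bounds give \<open>h1 G = |E| - |V| + 1\<close>, where
    \<open>|E| = 2 * n\<close> and \<open>h1 G = n\<close>.\<close>
  thus card: "card (verts G) = n + 1"
    using h1_lower_bound[OF simple] h1_upper_bound[OF simple conn] conn G(3)
    by (simp add: connected_graph_def)
  have deg: "card (nonneighbours G v) + card (incident G v) = n" if "v \<in> verts G" for v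
    using card_nonneighbours[OF simple that] card by simp
  \<comment> \<open>Each of the \<open>n + 1\<close> vertices contributes \<open>n\<close> to both
    sums together, while the degrees alone add up to \<open>4 * n\<close>.\<close>
  have "(\<Sum>v\<in>verts G. card (nonneighbours G v)) + (\<Sum>v\<in>verts G. card (incident G v)) = n * (n + 1)"
    using card by (simp add: sum.distrib[symmetric] deg)
  thus total: "(\<Sum>v\<in>verts G. card (nonneighbours G v)) + 4 * n = n * (n + 1)"
    using handshake[OF simple] G(3) by simp
  hence "4 * n \<le> n * (n + 1)" by linarith
  hence "4 * n \<le> (n + 1) * n" by (simp only: mult.commute)
  thus n3: "n \<ge> 3" using \<open>n > 0\<close> by (simp only: mult_le_cancel2) simp
  fix v assume v: "v \<in> verts G"
  have "card (verts G - {v}) = n" using v card fin by simp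
  moreover from this have "verts G - {v} \<noteq> {}" using n3 by force
  \<comment> \<open>A path from \<open>v\<close> to another vertex starts with an edge at
    \<open>v\<close>, so deleting \<open>v\<close> leaves a proper subset of the edges and the
    sparsity bound applies.\<close>
  moreover have "edges G - incident G v \<subset> edges G"
  proof -
    obtain w where w: "w \<in> verts G" "w \<noteq> v" using \<open>verts G - {v} \<noteq> {}\<close> by blast
    hence "(v, w) \<in> {(x, y). {x, y} \<in> edges G}\<^sup>*" using conn v by (simp add: connected_graph_def)
    then obtain y where "{v, y} \<in> edges G" using w by (cases rule: converse_rtranclE) auto
    moreover from this have "{v, y} \<in> incident G v" by (simp add: incident_def)
    ultimately show ?thesis by blast
  qed
  moreover have "e \<subseteq> verts G - {v}" if "e \<in> edges G - incident G v" for e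
    using that simple by (auto simp: incident_def simple_graph_def)
  ultimately have "edges G - incident G v \<noteq> {} \<longrightarrow> card (edges G - incident G v) + 3 \<le> 2 * n"
    using proper_edge_subset_sparse[OF simple G(2), of "verts G - {v}" "edges G - incident G v"] by auto
  moreover have "card (edges G - incident G v) + card (incident G v) = 2 * n"
  proof -
    have "incident G v \<subseteq> edges G" by (auto simp: incident_def)
    thus ?thesis
      using card_Diff_subset[of "incident G v" "edges G"] card_mono[of "edges G" "incident G v"] fin G(3)
      by (simp add: finite_subset)
  qed
  \<comment> \<open>If edges survive, \<open>2 * n - deg + 3 \<le> 2 * n\<close> gives the claim;
    otherwise all \<open>2 * n\<close> edges meet \<open>v\<close>.\<close>
  ultimately have "card (incident G v) \<ge> 3" using n3 by (cases "edges G - incident G v = {}") auto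
  thus "card (nonneighbours G v) + 3 \<le> n" using deg[OF v] by simp
qed

text \<open>The labelling runs from \<open>H\<close> to \<open>G\<close> because the targets have
  explicit vertices; its inverse is the isomorphism. On the diagonal the equivalence would fail, as
  no vertex is its own nonneighbour.\<close>

lemma isomorphic_by_labelling:
  assumes G: "simple_graph G" and H: "simple_graph H" and g: "bij_betw g (verts H) (verts G)"
    and adj: "\<And>i j. i \<in> verts H \<Longrightarrow> j \<in> verts H \<Longrightarrow> i \<noteq> j \<Longrightarrow> g i \<in> nonneighbours G (g j) \<longleftrightarrow> {i, j} \<notin> edges H"
  shows "isomorphic G H"
proof -
  have inj: "g i = g j \<longleftrightarrow> i = j" if "i \<in> verts H" "j \<in> verts H" for i j
    using g that by (auto simp: bij_betw_def inj_on_def)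
  have gV: "g i \<in> verts G" if "i \<in> verts H" for i
    using g that by (auto simp: bij_betw_def)
  have adj': "{g i, g j} \<in> edges G \<longleftrightarrow> {i, j} \<in> edges H"
    if "i \<in> verts H" "j \<in> verts H" "i \<noteq> j" for i j
    using adj[OF that] inj[OF that(1,2)] gV that by (auto simp: nonneighbours_def)
  define f where "f = the_inv_into (verts H) g"
  have f: "bij_betw f (verts G) (verts H)" unfolding f_def by (rule bij_betw_the_inv_into[OF g])
  have fg: "f (g i) = i" if "i \<in> verts H" for i
    using g that by (simp add: f_def bij_betw_def the_inv_into_f_f)
  have surj: "\<exists>i\<in>verts H. u = g i" if "u \<in> verts G" for u
    using g that by (auto simp: bij_betw_def)
  have "edges H = (\<lambda>e. f ` e) ` edges G"
  proof (intro equalityI subsetI)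
    fix e assume e: "e \<in> edges H"
    then obtain i j where ij: "i \<in> verts H" "j \<in> verts H" "i \<noteq> j" "e = {i, j}"
      using H unfolding simple_graph_def by blast
    hence "{g i, g j} \<in> edges G" using adj' e by simp
    moreover have "e = f ` {g i, g j}" using ij by (simp add: fg)
    ultimately show "e \<in> (\<lambda>e. f ` e) ` edges G" by blast
  next
    fix e assume "e \<in> (\<lambda>e. f ` e) ` edges G"
    then obtain d where d: "d \<in> edges G" "e = f ` d" by blast
    then obtain u v where uv: "u \<in> verts G" "v \<in> verts G" "u \<noteq> v" "d = {u, v}"
      using G unfolding simple_graph_def by blast
    obtain i j where ij: "i \<in> verts H" "u = g i" "j \<in> verts H" "v = g j"
      using surj uv by metis
    have "{i, j} \<in> edges H" using adj'[of i j] ij uv d by auto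
    moreover have "e = {i, j}" using d uv ij fg by simp
    ultimately show "e \<in> edges H" by simp
  qed
  thus ?thesis using f unfolding isomorphic_def by blast
qed

section \<open>Small graphs of maximal degree at most two\<close>

text \<open>A single smaller value would push the sum strictly below
  \<open>m * card S\<close>.\<close>

lemma sum_attains_upper_bound:
  fixes f :: "'a \<Rightarrow> nat"
  assumes "finite S" "\<And>x. x \<in> S \<Longrightarrow> f x \<le> m" "sum f S = m * card S" "x \<in> S"
  shows "f x = m"
proof (rule ccontr)
  assume "f x \<noteq> m"
  hence "sum f S < (\<Sum>x\<in>S. m)"
    using assms by (intro sum_strict_mono_ex1) (auto intro!: bexI[of _ x] simp: le_neq_implies_less)
  thus False using assms by (simp add: mult.commute)
qed

lemma obtain_remaining:
  assumes "finite V" "S \<subseteq> V" "card V = card S + k"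
  obtains T where "V = S \<union> T" "S \<inter> T = {}" "card T = k"
proof
  show "V = S \<union> (V - S)" "S \<inter> (V - S) = {}" using assms by auto
  show "card (V - S) = k" using assms by (simp add: card_Diff_subset finite_subset)
qed

text \<open>A finite loopless graph given by its neighbourhoods, so that its shape can be stated as
  equations for \<open>N\<close>. It is meant for the complement of \<open>G\<close>.\<close>

locale symmetric_relation =
  fixes V :: "'a set" and N :: "'a \<Rightarrow> 'a set"
  assumes finV: "finite V"
    and N_subset: "\<And>v. v \<in> V \<Longrightarrow> N v \<subseteq> V - {v}"
    and N_sym: "\<And>u v. v \<in> V \<Longrightarrow> u \<in> N v \<Longrightarrow> v \<in> N u"
begin

lemma N_mem: "v \<in> V \<Longrightarrow> u \<in> N v \<Longrightarrow> u \<in> V \<and> u \<noteq> v \<and> v \<in> N u"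
  using N_subset[of v] N_sym[of v u] by blast

lemma finite_N: "v \<in> V \<Longrightarrow> finite (N v)"
  using N_subset finV by (meson finite_Diff finite_subset)

lemma N_one: "card (N v) = 1 \<Longrightarrow> u \<in> N v \<Longrightarrow> N v = {u}"
  by (auto simp: card_1_singleton_iff)

lemma N_two_subset: "card (N v) = 2 \<Longrightarrow> N v \<subseteq> {x, y} \<Longrightarrow> N v = {x, y} \<and> x \<noteq> y"
  using card_mono[of "{x, y}" "N v"] card_subset_eq[of "{x, y}" "N v"]
  by (cases "x = y") (auto simp: card_insert_if)

lemma N_two_members: "v \<in> V \<Longrightarrow> card (N v) = 2 \<Longrightarrow> x \<in> N v \<Longrightarrow> y \<in> N v \<Longrightarrow> x \<noteq> y \<Longrightarrow> N v = {x, y}"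
  using card_subset_eq[of "N v" "{x, y}"] finite_N[of v] by simp

lemma N_two_obtain:
  assumes "v \<in> V" "card (N v) = 2" "x \<in> N v"
  obtains y where "N v = {x, y}" "y \<noteq> x"
  using assms by (auto simp: card_2_iff doubleton_eq_iff)

text \<open>Degrees at most 1 with sum 4 on five vertices leave one isolated vertex and degree 1
  elsewhere. Once \<open>a\<close> is matched with \<open>b\<close>, the last two vertices can only
  be matched with each other.\<close>

lemma perfect_matching_and_point:
  assumes "card V = 5" "\<And>v. v \<in> V \<Longrightarrow> card (N v) \<le> 1" "(\<Sum>v\<in>V. card (N v)) = 4"
  shows "\<exists>z a b c d. distinct [z, a, b, c, d] \<and> V = {z, a, b, c, d} \<and>
    N z = {} \<and> N a = {b} \<and> N b = {a} \<and> N c = {d} \<and> N d = {c}"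
proof -
  have "\<exists>z\<in>V. card (N z) = 0"
  proof (rule ccontr)
    assume "\<not> ?thesis"
    hence "\<And>v. v \<in> V \<Longrightarrow> card (N v) = 1" using assms(2) by (metis le_neq_implies_less less_one)
    thus False using assms by simp
  qed
  then obtain z where z: "z \<in> V" "card (N z) = 0" by blast
  hence Nz: "N z = {}" using finite_N by simp
  have "(\<Sum>v\<in>V - {z}. card (N v)) = 1 * card (V - {z})"
    using assms z finV by (simp add: sum.remove)
  hence one: "card (N v) = 1" if "v \<in> V" "v \<noteq> z" for v
    using sum_attains_upper_bound[of "V - {z}" "\<lambda>v. card (N v)" 1 v] that assms(2) finV by simp
  have "card (V - {z}) = 4" using assms z finV by simp
  hence "V - {z} \<noteq> {}" by (metis card.empty zero_neq_numeral)
  then obtain a where a: "a \<in> V" "a \<noteq> z" by blast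
  obtain b where Na: "N a = {b}" using one[OF a] by (auto simp: card_1_singleton_iff)
  have b: "b \<in> V" "b \<noteq> a" "a \<in> N b" "b \<noteq> z" using N_mem[OF a(1), of b] Na Nz by auto
  have Nb: "N b = {a}" using N_one[of b a] b one by blast
  obtain T where T: "V = {z, a, b} \<union> T" "{z, a, b} \<inter> T = {}" "card T = 2"
    using obtain_remaining[of V "{z, a, b}" 2] finV z a b assms(1) by auto
  then obtain c d where cd: "T = {c, d}" "c \<noteq> d" by (auto simp: card_2_iff)
  have c: "c \<in> V" "c \<noteq> z" using T cd by auto
  obtain x where Nc: "N c = {x}" using one[OF c] by (auto simp: card_1_singleton_iff)
  have "x \<in> V" "x \<noteq> c" "c \<in> N x" using N_mem[OF c(1), of x] Nc by auto
  hence "x = d" using T cd Na Nb Nz by auto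
  hence Nd: "N d = {c}" using N_one[of d c] \<open>x \<in> V\<close> \<open>c \<in> N x\<close> one T cd by auto
  have "distinct [z, a, b, c, d]" "V = {z, a, b, c, d}" using T cd a b by auto
  thus ?thesis using Nz Na Nb Nc Nd \<open>x = d\<close> by blast
qed

text \<open>Following neighbours from \<open>a\<close> gives \<open>b\<close>, \<open>e\<close> and
  then \<open>c\<close>. A triangle \<open>a\<close>, \<open>b\<close>, \<open>e\<close> would leave
  two vertices unable to reach degree 2, so \<open>c\<close> is new, and the last vertex
  \<open>d\<close> joins \<open>c\<close> to \<open>e\<close>.\<close>

lemma five_cycle_and_point:
  assumes "card V = 6" "z \<in> V" "N z = {}" and two: "\<And>v. v \<in> V \<Longrightarrow> v \<noteq> z \<Longrightarrow> card (N v) = 2"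
  shows "\<exists>a b c d e. distinct [z, a, b, c, d, e] \<and> V = {z, a, b, c, d, e} \<and>
    N a = {b, e} \<and> N b = {a, c} \<and> N c = {b, d} \<and> N d = {c, e} \<and> N e = {a, d}"
proof -
  have "card (V - {z}) = 5" using assms finV by simp
  hence "V - {z} \<noteq> {}" by (metis card.empty zero_neq_numeral)
  then obtain a where a: "a \<in> V" "a \<noteq> z" by blast
  obtain b e where Na: "N a = {b, e}" "b \<noteq> e" using two[OF a] by (auto simp: card_2_iff)
  have b: "b \<in> V" "b \<noteq> a" "a \<in> N b" "b \<noteq> z" using N_mem[OF a(1), of b] Na assms(3) by auto
  have e: "e \<in> V" "e \<noteq> a" "a \<in> N e" "e \<noteq> z" using N_mem[OF a(1), of e] Na assms(3) by auto
  obtain c where Nb: "N b = {a, c}" "c \<noteq> a" using N_two_obtain[of b a] b two by blast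
  have c: "c \<in> V" "c \<noteq> b" "b \<in> N c" "c \<noteq> z" using N_mem[OF b(1), of c] Nb assms(3) by auto
  have "c \<noteq> e"
  proof
    assume "c = e"
    hence Ne: "N e = {a, b}" using N_two_members[of e a b] e b c two by blast
    obtain T where T: "V = {z, a, b, e} \<union> T" "{z, a, b, e} \<inter> T = {}" "card T = 2"
      using obtain_remaining[of V "{z, a, b, e}" 2] finV assms a b e Na(2) by auto
    then obtain x y where xy: "T = {x, y}" "x \<noteq> y" by (auto simp: card_2_iff)
    have x: "x \<in> V" "x \<noteq> z" using T xy by auto
    have "N x \<subseteq> {y, y}"
    proof
      fix w assume "w \<in> N x"
      thus "w \<in> {y, y}" using N_mem[OF x(1), of w] T xy Na Nb Ne assms(3) \<open>c = e\<close> by auto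
    qed
    thus False using N_two_subset two[OF x] by blast
  qed
  obtain T where T: "V = {z, a, b, c, e} \<union> T" "{z, a, b, c, e} \<inter> T = {}" "card T = 1"
    using obtain_remaining[of V "{z, a, b, c, e}" 1] finV assms a b c e Na(2) Nb(2) \<open>c \<noteq> e\<close> by auto
  then obtain d where d: "T = {d}" by (auto simp: card_1_singleton_iff)
  have dV: "d \<in> V" "d \<noteq> z" using T d by auto
  have "N d \<subseteq> {c, e}"
  proof
    fix w assume "w \<in> N d"
    thus "w \<in> {c, e}" using N_mem[OF dV(1), of w] T d Na Nb assms(3) by auto
  qed
  hence Nd: "N d = {c, e}" using N_two_subset two[OF dV] by blast
  hence "d \<in> N c" "d \<in> N e" using N_mem[OF dV(1)] by auto
  hence "N c = {b, d}" "N e = {a, d}"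
    using N_two_members[of c b d] N_two_members[of e a d] b c e two T d a by auto
  moreover have "distinct [z, a, b, c, d, e]" "V = {z, a, b, c, d, e}"
    using T d a b c e Na(2) Nb(2) \<open>c \<noteq> e\<close> by auto
  ultimately show ?thesis using Na Nb Nd by blast
qed

text \<open>The edge from \<open>p\<close> to \<open>q\<close> uses up both of its ends, so
  \<open>a\<close> has its neighbours among the other vertices, and the one vertex left over can
  only be adjacent to these two neighbours.\<close>

lemma four_cycle_and_edge:
  assumes "card V = 6" "p \<in> V" "q \<in> V" "p \<noteq> q" "N p = {q}" "N q = {p}"
    and two: "\<And>v. v \<in> V \<Longrightarrow> v \<noteq> p \<Longrightarrow> v \<noteq> q \<Longrightarrow> card (N v) = 2"
  shows "\<exists>a b c d. distinct [p, q, a, b, c, d] \<and> V = {p, q, a, b, c, d} \<and>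
    N a = {b, d} \<and> N b = {a, c} \<and> N c = {b, d} \<and> N d = {a, c}"
proof -
  obtain S where S: "V = {p, q} \<union> S" "{p, q} \<inter> S = {}" "card S = 4"
    using obtain_remaining[of V "{p, q}" 4] finV assms by auto
  hence "S \<noteq> {}" by force
  then obtain a where "a \<in> S" by blast
  hence a: "a \<in> V" "a \<noteq> p" "a \<noteq> q" using S by auto
  obtain b d where Na: "N a = {b, d}" "b \<noteq> d" using two[OF a] by (auto simp: card_2_iff)
  have b: "b \<in> V" "b \<noteq> a" "a \<in> N b" "b \<noteq> p" "b \<noteq> q" using N_mem[OF a(1), of b] Na a assms(5,6) by auto
  have d: "d \<in> V" "d \<noteq> a" "a \<in> N d" "d \<noteq> p" "d \<noteq> q" using N_mem[OF a(1), of d] Na a assms(5,6) by auto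
  obtain T where T: "V = {p, q, a, b, d} \<union> T" "{p, q, a, b, d} \<inter> T = {}" "card T = 1"
    using obtain_remaining[of V "{p, q, a, b, d}" 1] finV assms a b d Na(2) by auto
  then obtain c where c: "T = {c}" by (auto simp: card_1_singleton_iff)
  have cV: "c \<in> V" "c \<noteq> p" "c \<noteq> q" using T c by auto
  have "N c \<subseteq> {b, d}"
  proof
    fix w assume "w \<in> N c"
    thus "w \<in> {b, d}" using N_mem[OF cV(1), of w] T c Na assms(5,6) by auto
  qed
  hence Nc: "N c = {b, d}" using N_two_subset two[OF cV] by blast
  hence "c \<in> N b" "c \<in> N d" using N_mem[OF cV(1)] by auto
  hence "N b = {a, c}" "N d = {a, c}"
    using N_two_members[of b a c] N_two_members[of d a c] b d two T c by auto
  moreover have "distinct [p, q, a, b, c, d]" "V = {p, q, a, b, c, d}"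
    using T c a b d Na(2) assms(4) by auto
  ultimately show ?thesis using Na Nc by blast
qed

text \<open>Follow the path from \<open>p\<close>. Reaching \<open>q\<close> after two edges leaves
  three vertices, which form a triangle; after three edges it would leave two vertices that cannot
  have degree 2; otherwise the last vertex connects the path to \<open>q\<close>.\<close>

lemma path_and_remainder:
  assumes "card V = 6" "p \<in> V" "q \<in> V" "p \<noteq> q" "card (N p) = 1" "card (N q) = 1" "q \<notin> N p"
    and two: "\<And>v. v \<in> V \<Longrightarrow> v \<noteq> p \<Longrightarrow> v \<noteq> q \<Longrightarrow> card (N v) = 2"
  shows "(\<exists>a b c d. distinct [p, a, q, b, c, d] \<and> V = {p, a, q, b, c, d} \<and> N p = {a} \<and> N a = {p, q} \<and>
      N q = {a} \<and> N b = {c, d} \<and> N c = {b, d} \<and> N d = {b, c}) \<or>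
    (\<exists>a b c d. distinct [p, a, b, c, d, q] \<and> V = {p, a, b, c, d, q} \<and> N p = {a} \<and> N a = {p, b} \<and>
      N b = {a, c} \<and> N c = {b, d} \<and> N d = {c, q} \<and> N q = {d})"
proof -
  obtain a where Np: "N p = {a}" using assms(5) by (auto simp: card_1_singleton_iff)
  have a: "a \<in> V" "a \<noteq> p" "p \<in> N a" "a \<noteq> q" using N_mem[OF assms(2), of a] Np assms(7) by auto
  obtain x where Na: "N a = {p, x}" "x \<noteq> p" using N_two_obtain[of a p] a two by blast
  have x: "x \<in> V" "x \<noteq> a" "a \<in> N x" using N_mem[OF a(1), of x] Na by auto
  show ?thesis
  proof (cases "x = q")
    case True
    hence Nq: "N q = {a}" using N_one[of q a] x assms by blast
    obtain T where T: "V = {p, a, q} \<union> T" "{p, a, q} \<inter> T = {}" "card T = 3"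
      using obtain_remaining[of V "{p, a, q}" 3] finV assms a by auto
    then obtain b c d where bcd: "T = {b, c, d}" "b \<noteq> c" "b \<noteq> d" "c \<noteq> d" by (auto simp: card_3_iff)
    have NT: "N v \<subseteq> T - {v}" if "v \<in> T" for v
    proof
      fix w assume w: "w \<in> N v"
      have v: "v \<in> V" "v \<notin> {p, a, q}" using T that by auto
      thus "w \<in> T - {v}" using N_mem[OF v(1) w] T Np Na Nq True by auto
    qed
    have T2: "card (N v) = 2" if "v \<in> T" for v using that T two by auto
    have "N b = {c, d}" "N c = {b, d}" "N d = {b, c}"
      using NT[of b] NT[of c] NT[of d] T2[of b] T2[of c] T2[of d] bcd
        N_two_subset[of b c d] N_two_subset[of c b d] N_two_subset[of d b c] by auto
    moreover have "distinct [p, a, q, b, c, d]" "V = {p, a, q, b, c, d}"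
      using T bcd a assms(4) by auto
    ultimately show ?thesis using Np Na Nq True by blast
  next
    case False
    obtain y where Nx: "N x = {a, y}" "y \<noteq> a" using N_two_obtain[of x a] x Na False two by blast
    have y: "y \<in> V" "y \<noteq> x" "x \<in> N y" "y \<noteq> p" using N_mem[OF x(1), of y] Nx Np x by auto
    have "y \<noteq> q"
    proof
      assume "y = q"
      hence Nq: "N q = {x}" using N_one[of q x] y assms by blast
      obtain T where T: "V = {p, a, x, q} \<union> T" "{p, a, x, q} \<inter> T = {}" "card T = 2"
        using obtain_remaining[of V "{p, a, x, q}" 2] finV assms a x Na(2) False by auto
      then obtain u v where uv: "T = {u, v}" "u \<noteq> v" by (auto simp: card_2_iff)
      have u: "u \<in> V" "u \<noteq> p" "u \<noteq> q" using T uv by auto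
      have "N u \<subseteq> {v, v}"
      proof
        fix w assume "w \<in> N u"
        thus "w \<in> {v, v}" using N_mem[OF u(1), of w] T uv Np Na Nx Nq \<open>y = q\<close> by auto
      qed
      thus False using N_two_subset two[OF u] by blast
    qed
    obtain T where T: "V = {p, a, x, y, q} \<union> T" "{p, a, x, y, q} \<inter> T = {}" "card T = 1"
      using obtain_remaining[of V "{p, a, x, y, q}" 1] finV assms a x y Na(2) Nx(2) False \<open>y \<noteq> q\<close> by auto
    then obtain d where d: "T = {d}" by (auto simp: card_1_singleton_iff)
    have dV: "d \<in> V" "d \<noteq> p" "d \<noteq> q" using T d by auto
    \<comment> \<open>All neighbours of \<open>p\<close>, \<open>a\<close> and \<open>x\<close> are
      already named, and \<open>d\<close> is not among them.\<close>
    have "N d \<subseteq> {y, q}"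
    proof
      fix w assume "w \<in> N d"
      thus "w \<in> {y, q}" using N_mem[OF dV(1), of w] T d Np Na Nx by auto
    qed
    hence Nd: "N d = {y, q}" using N_two_subset two[OF dV] by blast
    hence "d \<in> N y" "d \<in> N q" using N_mem[OF dV(1)] by auto
    hence "N y = {x, d}" "N q = {d}"
      using N_two_members[of y x d] N_one[of q d] y two T d assms \<open>y \<noteq> q\<close> by auto
    moreover have "distinct [p, a, x, y, d, q]" "V = {p, a, x, y, d, q}"
      using T d a x y Na(2) Nx(2) False \<open>y \<noteq> q\<close> assms(4) by auto
    ultimately show ?thesis using Np Na Nx Nd by blast
  qed
qed

text \<open>The degrees fall short of 2 by \<open>12 - 10 = 2\<close> in total. Either one isolated
  vertex absorbs this, or exactly two vertices have degree 1; whether these are adjacent separates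
  \<open>?C4\<close> from \<open>?C3\<close> and \<open>?P6\<close>.\<close>

lemma five_edges_max_degree_two:
  assumes "card V = 6" "\<forall>v\<in>V. card (N v) \<le> 2" "(\<Sum>v\<in>V. card (N v)) = 10"
  shows "(\<exists>z a b c d e. distinct [z, a, b, c, d, e] \<and> V = {z, a, b, c, d, e} \<and> N z = {} \<and>
      N a = {b, e} \<and> N b = {a, c} \<and> N c = {b, d} \<and> N d = {c, e} \<and> N e = {a, d}) \<or>
    (\<exists>p q a b c d. distinct [p, q, a, b, c, d] \<and> V = {p, q, a, b, c, d} \<and> N p = {q} \<and> N q = {p} \<and>
      N a = {b, d} \<and> N b = {a, c} \<and> N c = {b, d} \<and> N d = {a, c}) \<or>
    (\<exists>p a q b c d. distinct [p, a, q, b, c, d] \<and> V = {p, a, q, b, c, d} \<and> N p = {a} \<and> N a = {p, q} \<and>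
      N q = {a} \<and> N b = {c, d} \<and> N c = {b, d} \<and> N d = {b, c}) \<or>
    (\<exists>p a b c d q. distinct [p, a, b, c, d, q] \<and> V = {p, a, b, c, d, q} \<and> N p = {a} \<and> N a = {p, b} \<and>
      N b = {a, c} \<and> N c = {b, d} \<and> N d = {c, q} \<and> N q = {d})"
    (is "?C5 \<or> ?C4 \<or> ?C3 \<or> ?P6")
proof (cases "\<exists>z\<in>V. N z = {}")
  case True
  then obtain z where z: "z \<in> V" "N z = {}" by blast
  have "(\<Sum>v\<in>V - {z}. card (N v)) = 2 * card (V - {z})"
    using assms z finV by (simp add: sum.remove)
  hence "card (N v) = 2" if "v \<in> V" "v \<noteq> z" for v
    using sum_attains_upper_bound[of "V - {z}" "\<lambda>v. card (N v)" 2 v] that assms(2) finV by simp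
  from five_cycle_and_point[OF assms(1) z this] have ?C5 using z by blast
  thus ?thesis by blast
next
  case False
  define D where "D = {v \<in> V. card (N v) = 1}"
  \<comment> \<open>Without isolated vertices each shortfall is 0 or 1, so \<open>of_bool\<close>
    records it and its sum counts \<open>D\<close>.\<close>
  have val: "card (N v) + of_bool (v \<in> D) = 2" if v: "v \<in> V" for v
  proof -
    have "card (N v) \<noteq> 0" using False v finite_N by auto
    thus ?thesis using assms(2) v by (auto simp: D_def)
  qed
  have "(\<Sum>v\<in>V. card (N v)) + (\<Sum>v\<in>V. of_bool (v \<in> D)) = 12"
    using assms(1) by (simp add: sum.distrib[symmetric] val)
  moreover have "(\<Sum>v\<in>V. of_bool (v \<in> D)) = card D"
    using finV by (simp add: D_def) (metis Collect_conj_eq Collect_mem_eq)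
  ultimately have "card D = 2" using assms(3) by simp
  then obtain p q where pq: "D = {p, q}" "p \<noteq> q" by (auto simp: card_2_iff)
  hence p: "p \<in> V" "card (N p) = 1" and q: "q \<in> V" "card (N q) = 1" by (auto simp: D_def)
  have two: "card (N v) = 2" if "v \<in> V" "v \<noteq> p" "v \<noteq> q" for v
    using val[OF that(1)] that pq by simp
  show ?thesis
  proof (cases "q \<in> N p")
    case True
    hence "N p = {q}" "N q = {p}" using N_one p q N_sym by blast+
    with four_cycle_and_edge[OF assms(1) p(1) q(1) pq(2) this two] have ?C4 by blast
    thus ?thesis by blast
  next
    case False
    have "?C3 \<or> ?P6"
    proof (rule disjE[OF path_and_remainder[OF assms(1) p(1) q(1) pq(2) p(2) q(2) False]], goal_cases)
      case 1
      thus ?case by (rule two)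
    next
      case 2
      thus ?case by (elim exE) (intro disjI1 exI, assumption)
    next
      case 3
      thus ?case by (elim exE) (intro disjI2 exI, assumption)
    qed
    thus ?thesis by blast
  qed
qed

end

section \<open>Identification of the graphs\<close>

text \<open>Zipped lists turn a labelling into finitely many explicit pairs, so that comparing
  adjacency with a concrete target becomes a matter of simplification.\<close>

lemma isomorphic_by_lists:
  assumes "simple_graph G" "simple_graph H"
    and ks: "distinct ks" "set ks = verts H" and xs: "distinct xs" "set xs = verts G"
    and len: "length ks = length xs"
    and adj: "\<forall>(i, x)\<in>set (zip ks xs). \<forall>(j, y)\<in>set (zip ks xs).
      i \<noteq> j \<longrightarrow> (x \<in> nonneighbours G y \<longleftrightarrow> {i, j} \<notin> edges H)"
  shows "isomorphic G H"
proof (rule isomorphic_by_labelling[OF assms(1,2)])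
  define g where "g i = the (map_of (zip ks xs) i)" for i
  have g: "g (ks ! k) = xs ! k" if "k < length ks" for k
    using that ks(1) len by (simp add: g_def map_of_zip_nth)
  have idx: "\<exists>k<length ks. i = ks ! k" if "i \<in> verts H" for i
    using that ks(2) by (metis in_set_conv_nth)
  show "bij_betw g (verts H) (verts G)"
  proof (rule bij_betw_imageI)
    show "inj_on g (verts H)"
    proof (rule inj_onI)
      fix i j assume "i \<in> verts H" "j \<in> verts H" "g i = g j"
      then obtain k l where "k < length ks" "l < length ks" "i = ks ! k" "j = ks ! l" "xs ! k = xs ! l"
        using idx[of i] idx[of j] g by auto
      thus "i = j" using xs(1) len by (simp add: nth_eq_iff_index_eq)
    qed
    have "map g ks = xs" using g len by (intro nth_equalityI) auto
    thus "g ` verts H = verts G" using ks(2) xs(2) by (metis set_map)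
  qed
  fix i j assume ij: "i \<in> verts H" "j \<in> verts H" "i \<noteq> j"
  have zip: "(i, g i) \<in> set (zip ks xs)" if "i \<in> verts H" for i
    using idx[OF that] g len by (auto simp: set_zip)
  show "g i \<in> nonneighbours G (g j) \<longleftrightarrow> {i, j} \<notin> edges H"
    using adj zip[OF ij(1)] zip[OF ij(2)] ij(3) by blast
qed

section \<open>Explicit vertex and edge lists of the target graphs\<close>

lemma WS_eqs:
  "verts (WS 3) = {0, 1, 2, 3}"
  "edges (WS 3) = {{0, 1}, {0, 2}, {0, 3}, {1, 2}, {2, 3}, {3, 1}}"
  "verts (WS 4) = {0, 1, 2, 3, 4}"
  "edges (WS 4) = {{0, 1}, {0, 2}, {0, 3}, {0, 4}, {1, 2}, {2, 3}, {3, 4}, {4, 1}}"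
  "verts (WS 5) = {0, 1, 2, 3, 4, 5}"
  "edges (WS 5) = {{0, 1}, {0, 2}, {0, 3}, {0, 4}, {0, 5}, {1, 2}, {2, 3}, {3, 4}, {4, 5}, {5, 1}}"
proof -
  \<comment> \<open>Comprehensions become images of intervals, whose members can be
    enumerated.\<close>
  have *: "{f i | i. 1 \<le> i \<and> i \<le> n} = f ` {1..n}" "{f i | i. 1 \<le> i \<and> i < n} = f ` {1..<n}"
    for f :: "nat \<Rightarrow> nat set" and n by auto
  have iv: "{1..3::nat} = {1, 2, 3}" "{1..4::nat} = {1, 2, 3, 4}" "{1..5::nat} = {1, 2, 3, 4, 5}"
    "{1..<3::nat} = {1, 2}" "{1..<4::nat} = {1, 2, 3}" "{1..<5::nat} = {1, 2, 3, 4}" by auto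
  show "verts (WS 3) = {0, 1, 2, 3}" "verts (WS 4) = {0, 1, 2, 3, 4}" "verts (WS 5) = {0, 1, 2, 3, 4, 5}"
    by (auto simp: WS_def)
  show
    "edges (WS 3) = {{0, 1}, {0, 2}, {0, 3}, {1, 2}, {2, 3}, {3, 1}}"
    "edges (WS 4) = {{0, 1}, {0, 2}, {0, 3}, {0, 4}, {1, 2}, {2, 3}, {3, 4}, {4, 1}}"
    "edges (WS 5) = {{0, 1}, {0, 2}, {0, 3}, {0, 4}, {0, 5}, {1, 2}, {2, 3}, {3, 4}, {4, 5}, {5, 1}}"
    unfolding WS_def * iv by (simp_all add: insert_commute numeral_eq_Suc)
qed

lemma ZZ5_eqs:
  "verts ZZ5 = {1, 2, 3, 4, 5, 6}"
  "edges ZZ5 = {{1, 2}, {2, 3}, {3, 4}, {4, 5}, {5, 6}, {1, 3}, {2, 4}, {3, 5}, {4, 6}, {1, 6}}"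
proof -
  have *: "{f i | i. 1 \<le> i \<and> i \<le> n} = f ` {1..n}" for f :: "nat \<Rightarrow> nat set" and n by auto
  have iv: "{1..4::nat} = {1, 2, 3, 4}" "{1..5::nat} = {1, 2, 3, 4, 5}" by auto
  show "verts ZZ5 = {1, 2, 3, 4, 5, 6}" by (auto simp: ZZ5_def)
  show "edges ZZ5 = {{1, 2}, {2, 3}, {3, 4}, {4, 5}, {5, 6}, {1, 3}, {2, 4}, {3, 5}, {4, 6}, {1, 6}}"
    unfolding ZZ5_def * iv by (simp add: insert_commute numeral_eq_Suc)
qed

lemma XX5_eqs:
  "verts XX5 = {1, 2, 3, 4, 5, 6}"
  "edges XX5 = {{1, 3}, {1, 4}, {1, 5}, {1, 6}, {2, 3}, {2, 4}, {2, 5}, {2, 6}, {3, 4}, {5, 6}}"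
proof -
  have *: "{{i, j} | i j. i \<in> A \<and> j \<in> B} = (\<Union>i\<in>A. (\<lambda>j. {i, j}) ` B)" for A B :: "nat set"
    by auto
  show "verts XX5 = {1, 2, 3, 4, 5, 6}" by (auto simp: XX5_def)
  show "edges XX5 = {{1, 3}, {1, 4}, {1, 5}, {1, 6}, {2, 3}, {2, 4}, {2, 5}, {2, 6}, {3, 4}, {5, 6}}"
    unfolding XX5_def * by (simp add: insert_commute)
qed

lemma ST5_eqs:
  "verts ST5 = {1, 2, 3, 4, 5, 6}"
  "edges ST5 = {{1, 2}, {1, 3}, {1, 4}, {1, 5}, {2, 3}, {2, 4}, {2, 5}, {6, 3}, {6, 4}, {6, 5}}"
proof -
  have *: "{{i, j} | i j. i \<in> A \<and> j \<in> B} = (\<Union>i\<in>A. (\<lambda>j. {i, j}) ` B)" for A B :: "nat set"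
    by auto
  show "verts ST5 = {1, 2, 3, 4, 5, 6}" by (auto simp: ST5_def)
  show "edges ST5 = {{1, 2}, {1, 3}, {1, 4}, {1, 5}, {2, 3}, {2, 4}, {2, 5}, {6, 3}, {6, 4}, {6, 5}}"
    unfolding ST5_def * by (simp add: insert_commute)
qed

lemma simple_graphI:
  assumes "finite (verts G)" "\<And>e. e \<in> edges G \<Longrightarrow> e \<subseteq> verts G \<and> card e = 2"
  shows "simple_graph G"
  unfolding simple_graph_def
proof (intro conjI ballI)
  fix e assume "e \<in> edges G"
  with assms(2) obtain u v where "e = {u, v}" "u \<noteq> v" "e \<subseteq> verts G" by (meson card_2_iff)
  thus "\<exists>u\<in>verts G. \<exists>v\<in>verts G. u \<noteq> v \<and> e = {u, v}" by blast
qed (rule assms(1))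

lemma simple_targets:
  "simple_graph (WS 3)" "simple_graph (WS 4)" "simple_graph (WS 5)"
  "simple_graph ZZ5" "simple_graph XX5" "simple_graph ST5"
  by (rule simple_graphI; auto simp: WS_eqs ZZ5_eqs XX5_eqs ST5_eqs)+

theorem theorem3p1p3:
  fixes G :: "'a ugraph" and n :: nat
  assumes "graph G"
    and "primitively_log_divergent G"
    and "card (edges G) = 2 * n"
    and "n \<le> 5"
  shows "(n = 3 \<and> isomorphic G (WS 3)) \<or>
         (n = 4 \<and> isomorphic G (WS 4)) \<or>
         (n = 5 \<and> (isomorphic G (WS 5) \<or> isomorphic G ZZ5 \<or> isomorphic G XX5 \<or> isomorphic G ST5))"
proof -
  note N = primitive_nonneighbours[OF assms(1-3)]
  have simple: "simple_graph G" using assms by (simp add: graph_def)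
  interpret symmetric_relation "verts G" "nonneighbours G"
    using simple by unfold_locales (auto simp: simple_graph_def nonneighbours_def insert_commute)
  note iso = isomorphic_by_lists[OF simple]
  consider "n = 3" | "n = 4" | "n = 5" using N(2) assms(4) by linarith
  thus ?thesis
  proof cases
    case 1
    \<comment> \<open>Complement degrees are at most \<open>n - 3 = 0\<close>, so \<open>G\<close>
      is complete on four vertices and any enumeration is a labelling.\<close>
    have empty: "nonneighbours G v = {}" if "v \<in> verts G" for v
      using N(3)[OF that] finite_N[OF that] 1 by simp
    have "card (verts G) = 4" using N(1) 1 by simp
    then obtain xs where xs: "set xs = verts G" "distinct xs" "length xs = 4"
      by (metis distinct_card finV finite_distinct_list)
    then obtain a b c d where "xs = [a, b, c, d]" by (auto simp: length_Suc_conv numeral_eq_Suc)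
    with xs have "verts G = {a, b, c, d}" "distinct [a, b, c, d]" by auto
    hence "isomorphic G (WS 3)"
      by (intro iso[where xs = "[a, b, c, d]" and ks = "[0, 1, 2, 3]"])
        (simp_all add: simple_targets WS_eqs empty doubleton_eq_iff)
    thus ?thesis using 1 by blast
  next
    case 2
    \<comment> \<open>Complement degrees are at most 1, with sum \<open>20 - 16 = 4\<close>.\<close>
    have "\<exists>z a b c d. distinct [z, a, b, c, d] \<and> verts G = {z, a, b, c, d} \<and> nonneighbours G z = {} \<and>
      nonneighbours G a = {b} \<and> nonneighbours G b = {a} \<and> nonneighbours G c = {d} \<and> nonneighbours G d = {c}"
      by (rule perfect_matching_and_point) (use N 2 in force)+
    then obtain z a b c d where "distinct [z, a, b, c, d]" "verts G = {z, a, b, c, d}" "nonneighbours G z = {}"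
      "nonneighbours G a = {b}" "nonneighbours G b = {a}" "nonneighbours G c = {d}" "nonneighbours G d = {c}"
      by blast
    \<comment> \<open>The isolated vertex \<open>z\<close> of the complement becomes the hub; the
      rim order \<open>a\<close>, \<open>c\<close>, \<open>b\<close>, \<open>d\<close> puts matched
      vertices opposite each other.\<close>
    hence "isomorphic G (WS 4)"
      by (intro iso[where xs = "[z, a, c, b, d]" and ks = "[0, 1, 2, 3, 4]"])
        (auto simp: simple_targets WS_eqs doubleton_eq_iff)
    thus ?thesis using 2 by blast
  next
    case 3
    \<comment> \<open>The complement degree sum is \<open>30 - 20 = 10\<close>.\<close>
    have "card (verts G) = 6" "\<forall>v\<in>verts G. card (nonneighbours G v) \<le> 2"
      "(\<Sum>v\<in>verts G. card (nonneighbours G v)) = 10" using N 3 by force+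
    from five_edges_max_degree_two[OF this]
    have "isomorphic G (WS 5) \<or> isomorphic G XX5 \<or> isomorphic G ST5 \<or> isomorphic G ZZ5"
    proof (elim disjE exE conjE, goal_cases)
      case (1 z a b c d e)
      \<comment> \<open>The complement of a five-cycle is the five-cycle through every second
        vertex, whence the rim order \<open>a\<close>, \<open>c\<close>, \<open>e\<close>,
        \<open>b\<close>, \<open>d\<close>.\<close>
      hence "isomorphic G (WS 5)"
        by (intro iso[where xs = "[z, a, c, e, b, d]" and ks = "[0, 1, 2, 3, 4, 5]"])
          (auto simp: simple_targets WS_eqs doubleton_eq_iff)
      thus ?case by blast
    next
      case (2 p q a b c d)
      \<comment> \<open>The nonadjacent pair 1, 2 is \<open>p\<close>, \<open>q\<close>; the edges
        \<open>{3, 4}\<close> and \<open>{5, 6}\<close> are the diagonals of the complementary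
        four-cycle.\<close>
      hence "isomorphic G XX5"
        by (intro iso[where xs = "[p, q, a, c, b, d]" and ks = "[1, 2, 3, 4, 5, 6]"])
          (auto simp: simple_targets XX5_eqs doubleton_eq_iff)
      thus ?case by blast
    next
      case (3 p a q b c d)
      \<comment> \<open>In the complement of \<open>ST5\<close>, 3, 4, 5 form the triangle and 6 is
        the midpoint of the path from 1 to 2.\<close>
      hence "isomorphic G ST5"
        by (intro iso[where xs = "[p, q, b, c, d, a]" and ks = "[1, 2, 3, 4, 5, 6]"])
          (auto simp: simple_targets ST5_eqs doubleton_eq_iff)
      thus ?case by blast
    next
      case (4 p a b c d q)
      \<comment> \<open>The complement of \<open>ZZ5\<close> is the path 4, 1, 5, 2, 6, 3, matched
        here with \<open>p\<close>, \<open>a\<close>, \<open>b\<close>, \<open>c\<close>,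
        \<open>d\<close>, \<open>q\<close>.\<close>
      hence "isomorphic G ZZ5"
        by (intro iso[where xs = "[a, c, q, p, b, d]" and ks = "[1, 2, 3, 4, 5, 6]"])
          (auto simp: simple_targets ZZ5_eqs doubleton_eq_iff)
      thus ?case by blast
    qed
    thus ?thesis using 3 by blast
  qed
qed

end
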